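(* Let $N\ge \ell\ge 1$ and $k\ge1$ be integers, and let $\sigma=p_1\cdots p_k$, where $p_1,\dots,p_k$ are independent, each uniformly random among the $(N-1)!$ cycles of length $N$ in $S_N$. Let $p_{A_1}(N,\ell;k)$ be the probability that every cycle of $\sigma$ contains at least one element of $\{1,\dots,\ell\}$. Then \[ p_{A_1}(N,\ell;k)=\binom{N}{\ell}^{-1}\sum_{\lambda_1=\ell}^N(-1)^{(k-1)(N-\lambda_1)}\binom{N-1}{N-\lambda_1}^{-k+1}\binom{\lambda_1-1}{\ell-1}. \] *)

theory Defs
  imports "HOL-Probability.Probability" "HOL-Combinatorics.Combinatorics"
begin

text \<open>
  As in the library, an element of the symmetric group \<open>S\<^sub>N\<close> is a function
  \<open>p :: nat \<Rightarrow> nat\<close> with \<open>p permutes {1..N}\<close>, which fixes everything outside \<open>{1..N}\<close>.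
\<close>

definition full_cycles :: "nat \<Rightarrow> (nat \<Rightarrow> nat) set" where
  "full_cycles N = {p. p permutes {1..N} \<and> cyclic_on p {1..N}}"

text \<open>
  The cycles of a permutation of \<open>A\<close>, identified with their underlying subsets of \<open>A\<close>.
  Fixed points in \<open>A\<close> count as cycles of length one.
\<close>

definition cycles_in :: "'a set \<Rightarrow> ('a \<Rightarrow> 'a) \<Rightarrow> 'a set set" where
  "cycles_in A p = orbit p ` A"

text \<open>
  The distribution of \<open>p\<^sub>1 \<cdots> p\<^sub>k\<close>. Products are compositions of functions, with the rightmost
  factor applied first; as the factors are independent and identically distributed, the
  opposite convention gives the same distribution.
\<close>

definition cycle_product_pmf :: "nat \<Rightarrow> nat \<Rightarrow> (nat \<Rightarrow> nat) pmf" where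
  "cycle_product_pmf N k =
     map_pmf (\<lambda>ps. foldr (\<circ>) ps id) (replicate_pmf k (pmf_of_set (full_cycles N)))"

definition p_A1 :: "nat \<Rightarrow> nat \<Rightarrow> nat \<Rightarrow> real" where
  "p_A1 N l k =
     measure_pmf.prob (cycle_product_pmf N k) {\<sigma>. \<forall>C\<in>cycles_in {1..N} \<sigma>. C \<inter> {1..l} \<noteq> {}}"

text \<open>
  The library leaves \<^const>\<open>pmf_of_set\<close> unspecified on infinite and on empty sets; the next two
  lemmas show that its use above is meaningful for \<open>N \<ge> 1\<close>.
\<close>

lemma finite_full_cycles: "finite (full_cycles N)"
  by (rule finite_subset[OF _ finite_permutations[of "{1..N}"]]) (auto simp: full_cycles_def)

lemma full_cycles_nonempty:
  assumes "N \<ge> 1"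
  shows "full_cycles N \<noteq> {}"
proof -
  define cs where "cs = [1..<Suc N]"
  define p where "p = cycle_of_list cs"
  have set_cs: "set cs = {1..N}" and dist: "distinct cs" and len: "length cs = N"
    by (auto simp: cs_def)
  have perm: "p permutes {1..N}"
    using cycle_permutes[of cs] by (simp add: p_def set_cs)
  have iter: "(p ^^ n) 1 = Suc n" if "n < N" for n
  proof -
    have "map (p ^^ n) cs ! 0 = rotate n cs ! 0"
      using cyclic_rotation[OF dist, of n] by (simp add: p_def)
    moreover have "map (p ^^ n) cs ! 0 = (p ^^ n) 1"
      using assms len nth_map[of 0 cs "p ^^ n"] by (simp add: cs_def nth_upt del: upt_Suc)
    moreover have "rotate n cs ! 0 = Suc n"
      using assms len that nth_rotate[of 0 cs n] by (simp add: cs_def nth_upt del: upt_Suc)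
    ultimately show ?thesis by simp
  qed
  have "permutation p"
    using perm by (auto simp: permutation_permutes)
  hence orb: "orbit p 1 = {(p ^^ n) 1 | n. True}"
    by (rule orbit_altdef_permutation)
  have "{1..N} \<subseteq> orbit p 1"
  proof
    fix x assume "x \<in> {1..N}"
    hence "(p ^^ (x - 1)) 1 = x" by (subst iter) auto
    thus "x \<in> orbit p 1" unfolding orb by (smt (verit) mem_Collect_eq)
  qed
  moreover have "orbit p 1 \<subseteq> {1..N}"
    using permutes_orbit_subset[OF perm] assms by auto
  ultimately have "cyclic_on p {1..N}"
    using assms by (intro cyclic_on_singleI[of 1]) auto
  with perm show ?thesis by (auto simp: full_cycles_def)
qed

end

theory Submission
  imports Defs
begin

text \<open>
  For a set \<open>A\<close> with \<open>\<sigma> ` A = A\<close> let \<open>vsign \<sigma> A\<close> be the sign of the restriction of \<open>\<sigma>\<close> to \<open>A\<close>.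
  Inclusion-exclusion over the unions \<open>A\<close> of cycles that avoid \<open>{1..l}\<close> expresses the
  event as the sum of \<open>(-1) ^ card A * vsign \<sigma> A\<close> over the \<open>\<sigma>\<close>-invariant \<open>A \<subseteq> {l<..N}\<close>.
  The expectation of \<open>of_bool (\<sigma> ` A = A) * vsign \<sigma> A\<close> is a diagonal entry of the
  average of \<open>\<sigma>\<close> acting on the exterior power \<open>\<Lambda>\<^sup>j \<real>\<^sup>N\<close>, \<open>j = card A\<close>. By conjugation invariance the
  average of a single full cycle is a multiple of the operator \<open>swap_sum\<close>, which exchanges one
  element of \<open>A\<close> for one outside; since \<open>swap_sum\<close> satisfies a quadratic equation, the \<open>k\<close>-th
  power of the average is explicit, with eigenvalues \<open>(-1) ^ j / ((N - 1) choose j)\<close> and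
  \<open>(-1) ^ (j - 1) / ((N - 1) choose (j - 1))\<close>: the normalised characters of a full cycle at the
  hooks \<open>(N - j, 1\<^sup>j)\<close> and \<open>(N - j + 1, 1\<^sup>j\<^sup>-\<^sup>1)\<close>.
\<close>

subsection \<open>Minors of permutation matrices\<close>

abbreviation tr :: "'a \<Rightarrow> 'a \<Rightarrow> 'a \<Rightarrow> 'a" where
  "tr \<equiv> Transposition.transpose"

text \<open>The order only selects one representative of each unordered pair. For symmetric
  \<open>f\<close> the product is independent of this choice, so it can be transported along
  injections that are not monotone.\<close>

definition pairs_prod :: "('a::linorder \<Rightarrow> 'a \<Rightarrow> 'b::comm_monoid_mult) \<Rightarrow> 'a set \<Rightarrow> 'b" where
  "pairs_prod f A = (\<Prod>(x, y)\<in>{(x, y)\<in>A \<times> A. x < y}. f x y)"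

lemma pairs_prod_empty [simp]: "pairs_prod f {} = 1"
  by (simp add: pairs_prod_def)

lemma pairs_prod_insert:
  assumes "finite A" and "a \<notin> A" and sym: "\<And>x y. f x y = f y x"
  shows "pairs_prod f (insert a A) = (\<Prod>x\<in>A. f a x) * pairs_prod f A"
proof -
  let ?P = "{(x, y)\<in>A \<times> A. x < y}"
  let ?U = "Pair a ` {x\<in>A. a < x}"
  let ?D = "(\<lambda>x. (x, a)) ` {x\<in>A. x < a}"
  have fin: "finite ?P" "finite ?U" "finite ?D"
    using assms(1) by (auto intro: finite_subset[of _ "A \<times> A"])
  have eq: "{(x, y)\<in>insert a A \<times> insert a A. x < y} = ?U \<union> ?D \<union> ?P"
    by auto
  have "pairs_prod f (insert a A) =
      (\<Prod>(x, y)\<in>?U. f x y) * (\<Prod>(x, y)\<in>?D. f x y) * pairs_prod f A"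
    unfolding pairs_prod_def eq
    using fin assms(2) by (subst prod.union_disjoint; auto)+
  also have "(\<Prod>(x, y)\<in>?U. f x y) = (\<Prod>x\<in>{x\<in>A. a < x}. f a x)"
    by (subst prod.reindex) (auto intro: inj_onI)
  also have "(\<Prod>(x, y)\<in>?D. f x y) = (\<Prod>x\<in>{x\<in>A. x < a}. f a x)"
    by (subst prod.reindex) (auto intro: inj_onI simp: sym)
  also have "(\<Prod>x\<in>{x\<in>A. a < x}. f a x) * (\<Prod>x\<in>{x\<in>A. x < a}. f a x) = (\<Prod>x\<in>A. f a x)"
    using assms(1,2)
    by (subst prod.union_disjoint [symmetric])
      (use linorder_less_linear in \<open>fastforce intro!: prod.cong\<close>)+
  finally show ?thesis .
qed

lemma pairs_prod_image:
  assumes "finite A" and "inj_on p A" and sym: "\<And>x y. f x y = f y x"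
  shows "pairs_prod f (p ` A) = pairs_prod (\<lambda>x y. f (p x) (p y)) A"
  using assms(1,2)
proof induction
  case (insert a A)
  then have "p a \<notin> p ` A" and "inj_on p A" by auto
  then show ?case
    using insert by (simp add: pairs_prod_insert[OF _ _ sym] pairs_prod_insert[of A a "\<lambda>x y. f (p x) (p y)"] sym prod.reindex)
qed simp

lemma pairs_prod_mult: "pairs_prod (\<lambda>x y. f x y * g x y) A = pairs_prod f A * pairs_prod g A"
  by (simp add: pairs_prod_def prod.distrib case_prod_beta)

lemma pairs_prod_cong:
  "(\<And>x y. x \<in> A \<Longrightarrow> y \<in> A \<Longrightarrow> x < y \<Longrightarrow> f x y = g x y) \<Longrightarrow> pairs_prod f A = pairs_prod g A"
  by (auto simp: pairs_prod_def intro!: prod.cong)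

lemma pairs_prod_union:
  assumes "finite A" and "finite B" and "A \<inter> B = {}" and sym: "\<And>x y. f x y = f y x"
  shows "pairs_prod f (A \<union> B) = pairs_prod f A * pairs_prod f B * (\<Prod>x\<in>A. \<Prod>y\<in>B. f x y)"
  using assms(1,3)
proof induction
  case (insert a A)
  then have "pairs_prod f (insert a (A \<union> B)) =
      ((\<Prod>x\<in>A. f a x) * (\<Prod>y\<in>B. f a y)) * pairs_prod f (A \<union> B)"
    using assms(2) by (subst pairs_prod_insert[OF _ _ sym]) (auto simp: prod.union_disjoint)
  then show ?case
    using insert by (simp add: pairs_prod_insert[OF _ _ sym] ac_simps)
qed simp

text \<open>
  The \<open>p ` A\<close>-\<open>A\<close> minor of the permutation matrix of \<open>p\<close>, up to the factor
  \<open>\<bar>V (p ` A) / V A\<bar>\<close> with \<open>V\<close> the Vandermonde determinant. With this normalisation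
  the multiplicativity \<open>vsign_comp\<close> is a telescoping of quotients.
\<close>

definition vsign :: "(nat \<Rightarrow> nat) \<Rightarrow> nat set \<Rightarrow> real" where
  "vsign p A = pairs_prod (\<lambda>x y. (real (p y) - real (p x)) / (real y - real x)) A"

lemma diff_quotient_sym:
  "(real (p y) - real (p x)) / (real y - real x) = (real (p x) - real (p y)) / (real x - real y)"
  by (metis minus_diff_eq minus_divide_divide)

lemma vsign_cong: "(\<And>x. x \<in> A \<Longrightarrow> p x = q x) \<Longrightarrow> vsign p A = vsign q A"
  unfolding vsign_def by (intro pairs_prod_cong) simp

lemma vsign_id [simp]: "vsign id A = 1" "vsign (\<lambda>x. x) A = 1"
proof -
  show "vsign id A = 1"
    unfolding vsign_def pairs_prod_def by (intro prod.neutral) auto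
  then show "vsign (\<lambda>x. x) A = 1" by (simp add: id_def)
qed

lemma vsign_comp:
  assumes "finite A" and "inj_on p A"
  shows "vsign (q \<circ> p) A = vsign q (p ` A) * vsign p A"
proof -
  have "vsign q (p ` A) * vsign p A =
      pairs_prod (\<lambda>x y. (real (q (p y)) - real (q (p x))) / (real (p y) - real (p x)) *
        ((real (p y) - real (p x)) / (real y - real x))) A"
    unfolding vsign_def pairs_prod_mult
    using pairs_prod_image[OF assms, of "\<lambda>x y. (real (q y) - real (q x)) / (real y - real x)"]
    by (simp add: diff_quotient_sym)
  \<comment> \<open>Injectivity of \<open>p\<close> on \<open>A\<close> keeps the cancelled
    differences of values of \<open>p\<close> away from 0.\<close>
  also have "\<dots> = vsign (q \<circ> p) A"
    unfolding vsign_def using assms(2) by (intro pairs_prod_cong) (auto simp: inj_on_eq_iff)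
  finally show ?thesis by simp
qed

text \<open>The factors of pairs with one point in each set cancel: \<open>p\<close> permutes
  \<open>A\<close> and \<open>B\<close> separately, so the numerators are the denominators in
  another order.\<close>

lemma vsign_union:
  assumes "finite A" and "finite B" and "A \<inter> B = {}" and "p ` A = A" and "p ` B = B"
  shows "vsign p (A \<union> B) = vsign p A * vsign p B"
proof -
  have inj: "inj_on p A" "inj_on p B"
    using assms by (auto intro: eq_card_imp_inj_on)
  have "(\<Prod>x\<in>A. \<Prod>y\<in>B. real (p y) - real (p x)) = (\<Prod>x\<in>p ` A. \<Prod>y\<in>p ` B. real y - real x)"
    using inj by (simp add: prod.reindex)
  also have "\<dots> = (\<Prod>x\<in>A. \<Prod>y\<in>B. real y - real x)"
    by (simp add: assms)
  finally have num: "(\<Prod>x\<in>A. \<Prod>y\<in>B. real (p y) - real (p x)) = (\<Prod>x\<in>A. \<Prod>y\<in>B. real y - real x)" .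
  have "(\<Prod>x\<in>A. \<Prod>y\<in>B. real y - real x) \<noteq> 0"
    using assms(1-3) by (auto simp: prod_zero_iff)
  then have "(\<Prod>x\<in>A. \<Prod>y\<in>B. (real (p y) - real (p x)) / (real y - real x)) = 1"
    by (simp add: prod_dividef num)
  then show ?thesis
    unfolding vsign_def
    by (subst pairs_prod_union[OF assms(1-3)]) (simp_all add: diff_quotient_sym)
qed

text \<open>For \<open>x\<close> in \<open>A\<close> other than \<open>a\<close> and
  \<open>b\<close>, the factors of the pairs {a, x} and {b, x} are reciprocal. The pair {a, b}
  contributes -1 and every remaining pair contributes 1.\<close>

lemma vsign_transpose:
  assumes "finite A" and "a \<in> A" and "b \<in> A" and "a \<noteq> b"
  shows "vsign (tr a b) A = -1"
proof -
  define B where "B = A - {a, b}"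
  have B: "finite B" "a \<notin> B" "b \<notin> B" "A = insert a (insert b B)"
    using assms by (auto simp: B_def)
  let ?f = "\<lambda>x y. (real (tr a b y) - real (tr a b x)) / (real y - real x)"
  have "vsign (tr a b) A = ?f a b * ((\<Prod>x\<in>B. ?f a x) * (\<Prod>x\<in>B. ?f b x)) * vsign (tr a b) B"
    unfolding vsign_def B(4) using B assms(4)
    by (subst pairs_prod_insert; (subst pairs_prod_insert)?) (auto simp: diff_quotient_sym)
  also have "(\<Prod>x\<in>B. ?f a x) * (\<Prod>x\<in>B. ?f b x) = (\<Prod>x\<in>B. ?f a x * ?f b x)"
    by (rule prod.distrib [symmetric])
  also have "\<dots> = 1"
  proof (intro prod.neutral ballI)
    fix x assume "x \<in> B"
    then show "?f a x * ?f b x = 1" using B by (auto simp: Transposition.transpose_def)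
  qed
  also have "vsign (tr a b) B = vsign id B"
    using B by (intro vsign_cong) (auto simp: Transposition.transpose_def)
  also have "?f a b = -1"
    using assms(4) by (simp add: divide_eq_eq)
  finally show ?thesis by simp
qed

subsection \<open>Splitting and merging cycles\<close>

text \<open>An invariant set contains the orbit of each of its points, so a cycle is a minimal
  nonempty invariant set. In this form, splitting and merging can be handled without iterates of
  \<open>p\<close>.\<close>

lemma cyclic_on_iff:
  assumes "finite A"
  shows "cyclic_on p A \<longleftrightarrow>
    A \<noteq> {} \<and> p ` A = A \<and> (\<forall>T\<subseteq>A. T \<noteq> {} \<longrightarrow> p ` T \<subseteq> T \<longrightarrow> T = A)" (is "_ \<longleftrightarrow> ?R")
proof
  assume cyc: "cyclic_on p A"
  have orb: "orbit p s = A" if "s \<in> A" for s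
    using cyc that by (rule orbit_cyclic_eq3)
  have min: "T = A" if T: "T \<subseteq> A" "T \<noteq> {}" "p ` T \<subseteq> T" for T
  proof -
    obtain s where s: "s \<in> T" using T by auto
    have "orbit p s \<subseteq> T"
    proof
      fix x assume "x \<in> orbit p s"
      then show "x \<in> T" by induction (use s T in auto)
    qed
    with orb[of s] s T show ?thesis by auto
  qed
  have "p ` A \<subseteq> A" using cyclic_on_inI[OF cyc] by auto
  moreover have "A \<noteq> {}" using cyc by (auto simp: cyclic_on_alldef)
  ultimately have "p ` A = A" by (intro min) auto
  with \<open>A \<noteq> {}\<close> min show ?R by blast
next
  assume R: ?R
  then obtain s where s: "s \<in> A" by blast
  have "orbit p s \<subseteq> A"
  proof
    fix x assume "x \<in> orbit p s"
    then show "x \<in> A" by induction (use s R in auto)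
  qed
  moreover have "p ` orbit p s \<subseteq> orbit p s" by (auto intro: orbit.step)
  moreover have "orbit p s \<noteq> {}" by (rule orbit_nonempty)
  ultimately have "orbit p s = A" using R by blast
  with s show "cyclic_on p A" by (auto simp: cyclic_on_def)
qed

lemma cyclic_on_imp_image: "cyclic_on p A \<Longrightarrow> p ` A = A"
  by (frule finite_cyclic_on) (simp add: cyclic_on_iff)

lemma cyclic_on_invariant:
  "cyclic_on p A \<Longrightarrow> T \<subseteq> A \<Longrightarrow> T \<noteq> {} \<Longrightarrow> p ` T \<subseteq> T \<Longrightarrow> T = A"
  by (frule finite_cyclic_on) (simp add: cyclic_on_iff)

lemma cyclic_on_singleton: "cyclic_on p {a} \<longleftrightarrow> p a = a"
  by (auto simp: cyclic_on_iff subset_singleton_iff)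

lemma tr_image_swap:
  "a \<in> A \<Longrightarrow> b \<notin> A \<Longrightarrow> tr a b ` A = insert b (A - {a})"
  "a \<notin> A \<Longrightarrow> b \<in> A \<Longrightarrow> tr a b ` A = insert a (A - {b})"
  "a \<notin> A \<Longrightarrow> b \<notin> A \<Longrightarrow> tr a b ` A = A"
  by (auto simp: Transposition.transpose_def image_iff split: if_splits)

lemma tr_image_involutory [simp]: "tr a b ` tr a b ` A = A"
  by (simp add: image_image)

text \<open>
  Minimality of \<open>A\<close> is inherited from \<open>S\<close>: if \<open>T \<subseteq> A\<close> is invariant under \<open>tr a b \<circ> p\<close>, then
  \<open>p\<close> leaves \<open>T \<union> (S - A)\<close> invariant if \<open>a \<in> T\<close>, and \<open>T\<close> itself otherwise.
\<close>

lemma cyclic_on_split: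
  assumes cyc: "cyclic_on p S" and A: "A \<subseteq> S" and ab: "a \<in> A" "b \<in> S - A"
    and pA: "p ` A = tr a b ` A"
  shows "cyclic_on (tr a b \<circ> p) A"
proof -
  have fin: "finite S" "finite A" using cyc A finite_cyclic_on finite_subset by blast+
  have S: "p ` S = S" using cyc by (rule cyclic_on_imp_image)
  have inj: "inj_on p S" using S fin by (intro eq_card_imp_inj_on) auto
  have pA': "p ` A = insert b (A - {a})" using ab by (simp add: pA tr_image_swap)
  have pSA: "p ` (S - A) = insert a (S - A - {b})"
    using inj_on_image_set_diff[OF inj, of S A] A S pA' ab by auto
  have "T = A" if T: "T \<subseteq> A" "T \<noteq> {}" "(tr a b \<circ> p) ` T \<subseteq> T" for T
  proof -
    have pT: "p ` T \<subseteq> tr a b ` T"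
      using image_mono[OF T(3), of "tr a b"] unfolding image_comp [symmetric] by simp
    have bT: "b \<notin> T" using T ab by auto
    show ?thesis
    proof (cases "a \<in> T")
      case True
      then have "p ` T \<subseteq> insert b (T - {a})" using pT bT by (simp add: tr_image_swap)
      then have "p ` (T \<union> (S - A)) \<subseteq> T \<union> (S - A)"
        using pSA True ab by auto
      then have "T \<union> (S - A) = S"
        using T A by (intro cyclic_on_invariant[OF cyc]) auto
      with T A show ?thesis by auto
    next
      case False
      then have "p ` T \<subseteq> T" using pT bT by (simp add: tr_image_swap)
      then have "T = S" using T A by (intro cyclic_on_invariant[OF cyc]) auto
      with bT ab show ?thesis by auto
    qed
  qed
  moreover have "(tr a b \<circ> p) ` A = A" unfolding image_comp [symmetric] pA by simp
  ultimately show ?thesis using ab fin by (auto simp: cyclic_on_iff)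
qed

text \<open>Since \<open>p\<close> is injective on \<open>S\<close>, the complement of
  \<open>A\<close> satisfies the same image condition with \<open>a\<close> and \<open>b\<close>
  exchanged, and \<open>cyclic_on_split\<close> applies to it.\<close>

lemma cyclic_on_split':
  assumes cyc: "cyclic_on p S" and A: "A \<subseteq> S" and ab: "a \<in> A" "b \<in> S - A"
    and pA: "p ` A = tr a b ` A"
  shows "cyclic_on (tr a b \<circ> p) (S - A)"
proof -
  have S: "p ` S = S" using cyc by (rule cyclic_on_imp_image)
  have inj: "inj_on p S" using S finite_cyclic_on[OF cyc] by (intro eq_card_imp_inj_on) auto
  have "p ` (S - A) = insert a (S - A - {b})"
    using inj_on_image_set_diff[OF inj, of S A] A S pA ab by (auto simp: tr_image_swap)
  then have "p ` (S - A) = tr b a ` (S - A)"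
    using ab by (simp add: tr_image_swap)
  then show ?thesis
    using cyclic_on_split[OF cyc, of "S - A" b a] ab A by (auto simp: transpose_commute)
qed

text \<open>An invariant \<open>T\<close> is mapped onto itself by finiteness, so \<open>q\<close>
  and \<open>tr a b\<close> have the same image on \<open>T\<close>. If \<open>T\<close> contained
  exactly one of \<open>a\<close> and \<open>b\<close>, then \<open>q\<close> would change the size
  of its part in \<open>A\<close>. Otherwise \<open>q\<close> preserves \<open>T\<close>, which is
  then a union of the cycles \<open>A\<close> and \<open>B\<close>; being nonempty, it must be both,
  since a single cycle would separate \<open>a\<close> from \<open>b\<close>.\<close>

lemma cyclic_on_merge:
  assumes q: "cyclic_on q A" "cyclic_on q B" and disj: "A \<inter> B = {}" and ab: "a \<in> A" "b \<in> B"
  shows "cyclic_on (tr a b \<circ> q) (A \<union> B)"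
proof -
  have fin: "finite A" "finite B" using q finite_cyclic_on by blast+
  have qAB: "q ` A = A" "q ` B = B" using q by (simp_all add: cyclic_on_imp_image)
  have tAB: "tr a b ` (A \<union> B) = A \<union> B" using ab by (intro transpose_image_eq) auto
  have inj: "inj_on q (A \<union> B)"
    using qAB fin by (intro eq_card_imp_inj_on) (auto simp: image_Un)
  have "T = A \<union> B" if T: "T \<subseteq> A \<union> B" "T \<noteq> {}" "(tr a b \<circ> q) ` T \<subseteq> T" for T
  proof -
    have finT: "finite T" using T fin finite_subset by blast
    have "inj_on (tr a b \<circ> q) T"
      using inj T by (intro comp_inj_on) (auto intro: inj_on_subset)
    then have "(tr a b \<circ> q) ` T = T" using T finT by (intro endo_inj_surj)
    then have "tr a b ` q ` T = T" unfolding image_comp [symmetric] .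
    then have qT: "q ` T = tr a b ` T" by (metis tr_image_involutory)
    have qTI: "q ` (T \<inter> A) = q ` T \<inter> A" "q ` (T \<inter> B) = q ` T \<inter> B"
      using T qAB inj by (auto simp: inj_on_image_Int[OF inj, of T] )
    have card: "card (q ` (T \<inter> A)) = card (T \<inter> A)"
      using inj by (intro card_image) (auto intro: inj_on_subset)
    have A: "T \<inter> A = A" if "q ` T = T" "T \<inter> A \<noteq> {}"
      using that qTI by (intro cyclic_on_invariant[OF q(1)]) auto
    have B: "T \<inter> B = B" if "q ` T = T" "T \<inter> B \<noteq> {}"
      using that qTI by (intro cyclic_on_invariant[OF q(2)]) auto
    consider "a \<in> T" "b \<in> T" | "a \<in> T" "b \<notin> T" | "a \<notin> T" "b \<in> T" | "a \<notin> T" "b \<notin> T" by blast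
    then show ?thesis
    proof cases
      case 1
      then have "q ` T = T" by (simp add: qT)
      with A B 1 ab T show ?thesis by blast
    next
      case 2
      then have "q ` (T \<inter> A) = T \<inter> A - {a}"
        using qT qTI ab disj by (auto simp: tr_image_swap)
      with card 2 ab fin have False
        by (metis IntI card_Diff1_less finite_Int less_irrefl)
      then show ?thesis ..
    next
      case 3
      then have "q ` (T \<inter> A) = insert a (T \<inter> A)"
        using qT qTI ab disj by (auto simp: tr_image_swap)
      with card 3 ab fin have False by simp
      then show ?thesis ..
    next
      case 4
      then have qTT: "q ` T = T" by (simp add: qT tr_image_swap)
      have "T \<inter> A = {}" using A[OF qTT] ab 4 by blast
      moreover have "T \<inter> B = {}" using B[OF qTT] ab 4 by blast
      ultimately show ?thesis using T by blast
    qed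
  qed
  moreover have "(tr a b \<circ> q) ` (A \<union> B) = A \<union> B"
    by (simp only: image_comp [symmetric] image_Un[of q] qAB tAB)
  ultimately show ?thesis using ab fin by (auto simp: cyclic_on_iff)
qed

text \<open>Induction on the size of \<open>A\<close>: composing with the transposition of
  \<open>a\<close> and \<open>p a\<close> makes \<open>a\<close> a fixed point, leaves a cycle on
  the other points, and costs a factor -1.\<close>

lemma vsign_cyclic:
  assumes "cyclic_on p A"
  shows "vsign p A = (-1) ^ (card A - 1)"
  using assms
proof (induction "card A" arbitrary: A p rule: less_induct)
  case less
  have fin: "finite A" using less.prems by (rule finite_cyclic_on)
  obtain a where a: "a \<in> A" using less.prems by (auto simp: cyclic_on_def)
  have pA: "p ` A = A" by (rule cyclic_on_imp_image) fact
  define b where "b = p a"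
  have b: "b \<in> A" using a pA by (auto simp: b_def)
  show ?case
  proof (cases "A = {a}")
    case True
    then show ?thesis by (simp add: vsign_def pairs_prod_insert[of "{}" a, simplified] diff_quotient_sym)
  next
    case False
    have "b \<noteq> a"
    proof
      assume "b = a"
      then have "{a} = A"
        using a by (intro cyclic_on_invariant[OF less.prems]) (auto simp: b_def)
      with False show False by simp
    qed
    then have tr_a: "p ` {a} = tr a b ` {a}" by (simp add: b_def)
    define q where "q = tr a b \<circ> p"
    have q: "cyclic_on q {a}" "cyclic_on q (A - {a})"
      unfolding q_def
      using cyclic_on_split[OF less.prems _ _ _ tr_a] cyclic_on_split'[OF less.prems _ _ _ tr_a]
        a b \<open>b \<noteq> a\<close> by auto
    have qA: "q ` A = A"
      using cyclic_on_imp_image[OF q(1)] cyclic_on_imp_image[OF q(2)] a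
      by (metis image_Un insert_Diff insert_is_Un)
    have "vsign p A = vsign (tr a b \<circ> q) A" by (simp add: q_def o_assoc)
    also have "\<dots> = vsign (tr a b) A * vsign q A"
      using fin qA by (subst vsign_comp) (auto intro: eq_card_imp_inj_on)
    also have "vsign (tr a b) A = -1"
      using fin a b \<open>b \<noteq> a\<close> by (intro vsign_transpose) auto
    also have "vsign q A = vsign q ({a} \<union> (A - {a}))"
      using a by (simp add: insert_absorb)
    also have "\<dots> = vsign q {a} * vsign q (A - {a})"
      using fin cyclic_on_imp_image[OF q(1)] cyclic_on_imp_image[OF q(2)]
      by (intro vsign_union) auto
    also have "vsign q {a} = 1"
      by (simp add: vsign_def pairs_prod_insert[of "{}" a, simplified] diff_quotient_sym)
    also have "vsign q (A - {a}) = (-1) ^ (card (A - {a}) - 1)"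
      using fin a by (intro less.hyps q) (metis card_Diff1_less)
    finally have "vsign p A = (-1) ^ Suc (card (A - {a}) - 1)" by simp
    also have "Suc (card (A - {a}) - 1) = card A - 1"
      using fin a b \<open>b \<noteq> a\<close>
      by (metis Suc_pred' card_Diff_singleton card_gt_0_iff finite_Diff insert_Diff insert_iff Diff_iff empty_iff singletonD)
    finally show ?thesis .
  qed
qed

subsection \<open>Counting full cycles\<close>

definition full_cycles_on :: "'a set \<Rightarrow> ('a \<Rightarrow> 'a) set" where
  "full_cycles_on S = {p. p permutes S \<and> cyclic_on p S}"

lemma finite_full_cycles_on: "finite S \<Longrightarrow> finite (full_cycles_on S)"
  by (rule finite_subset[OF _ finite_permutations[of S]]) (auto simp: full_cycles_on_def)

lemma perm_restrict_permutes:
  assumes "finite A" and "p ` A = A"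
  shows "perm_restrict p A permutes A"
proof (rule bij_imp_permutes)
  have "bij_betw p A A" using assms by (simp add: bij_betw_def eq_card_imp_inj_on)
  then show "bij_betw (perm_restrict p A) A A"
    by (rule bij_betw_cong[THEN iffD1, rotated]) (simp add: perm_restrict_simps)
qed (simp add: perm_restrict_simps)

text \<open>Composition of cycles with the disjoint supports \<open>A\<close> and \<open>B\<close>
  is inverted by restricting to \<open>A\<close> and to \<open>B\<close>.\<close>

lemma card_two_cycles:
  assumes fin: "finite A" "finite B" and disj: "A \<inter> B = {}"
  shows "card {q. q permutes A \<union> B \<and> cyclic_on q A \<and> cyclic_on q B} =
    card (full_cycles_on A) * card (full_cycles_on B)" (is "card ?Q = _")
proof -
  have "bij_betw (\<lambda>(f, g). f \<circ> g) (full_cycles_on A \<times> full_cycles_on B) ?Q"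
  proof (rule bij_betw_byWitness[where f' = "\<lambda>q. (perm_restrict q A, perm_restrict q B)"])
    have comp: "(f \<circ> g) x = f x" if "g permutes B" "x \<in> A" for f g :: "'a \<Rightarrow> 'a" and x
      using permutes_not_in[OF that(1), of x] that(2) disj by (simp add: disjoint_iff)
    have comp': "(f \<circ> g) x = g x" if "f permutes A" "g permutes B" "x \<in> B" for f g :: "'a \<Rightarrow> 'a" and x
      using that disj permutes_in_image[OF that(2), of x] permutes_not_in[OF that(1), of "g x"] by auto
    show "\<forall>x\<in>full_cycles_on A \<times> full_cycles_on B.
        (\<lambda>q. (perm_restrict q A, perm_restrict q B)) ((\<lambda>(f, g). f \<circ> g) x) = x"
    proof
      fix x assume "x \<in> full_cycles_on A \<times> full_cycles_on B"
      then obtain f g where x: "x = (f, g)" and *: "f permutes A" "g permutes B"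
        by (auto simp: full_cycles_on_def)
      have "perm_restrict (f \<circ> g) A = f" "perm_restrict (f \<circ> g) B = g"
        using comp[OF *(2), of _ f] comp'[OF *] * permutes_not_in[OF *(1)] permutes_not_in[OF *(2)]
        by (auto simp: perm_restrict_def fun_eq_iff)
      then show "(\<lambda>q. (perm_restrict q A, perm_restrict q B)) ((\<lambda>(f, g). f \<circ> g) x) = x"
        by (simp add: x)
    qed
    show "\<forall>q\<in>?Q. (\<lambda>(f, g). f \<circ> g) (perm_restrict q A, perm_restrict q B) = q"
      using disj by (auto simp: perm_restrict_comp)
    show "(\<lambda>(f, g). f \<circ> g) ` (full_cycles_on A \<times> full_cycles_on B) \<subseteq> ?Q"
    proof safe
      fix f g assume "f \<in> full_cycles_on A" "g \<in> full_cycles_on B"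
      then have *: "f permutes A" "g permutes B" "cyclic_on f A" "cyclic_on g B"
        by (auto simp: full_cycles_on_def)
      then show "f \<circ> g permutes A \<union> B"
        by (intro permutes_compose) (auto intro: permutes_subset)
      show "cyclic_on (f \<circ> g) A" using *(3) comp[OF *(2), of _ f] cyclic_cong by metis
      show "cyclic_on (f \<circ> g) B" using *(4) comp'[OF *(1,2)] cyclic_cong by metis
    qed
    show "(\<lambda>q. (perm_restrict q A, perm_restrict q B)) ` ?Q \<subseteq> full_cycles_on A \<times> full_cycles_on B"
      using fin by (auto simp: full_cycles_on_def cyclic_on_perm_restrict
          intro!: perm_restrict_permutes cyclic_on_imp_image)
  qed
  then show ?thesis
    by (simp add: bij_betw_same_card [symmetric] card_cartesian_product)
qed

text \<open>Left composition with \<open>tr a b\<close> is an involution. It cuts a full cycle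
  satisfying the image condition into cycles on \<open>A\<close> and \<open>S - A\<close>, and
  conversely glues two such cycles together.\<close>

lemma full_cycles_on_split:
  assumes "finite S" and A: "A \<subseteq> S" and ab: "a \<in> A" "b \<in> S - A"
  shows "{p \<in> full_cycles_on S. p ` A = tr a b ` A} =
    (\<circ>) (tr a b) ` {q. q permutes S \<and> cyclic_on q A \<and> cyclic_on q (S - A)}" (is "?L = _ ` ?Q")
proof -
  have perm: "tr a b \<circ> p permutes S" if "p permutes S" for p
    using that ab A by (intro permutes_compose permutes_swap_id) auto
  show ?thesis
  proof (intro subset_antisym subsetI)
    fix p assume "p \<in> ?L"
    then have p: "p permutes S" "cyclic_on p S" "p ` A = tr a b ` A"
      by (auto simp: full_cycles_on_def)
    then have "tr a b \<circ> p \<in> ?Q"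
      using cyclic_on_split[OF p(2) A ab p(3)] cyclic_on_split'[OF p(2) A ab p(3)] perm by auto
    moreover have "p = tr a b \<circ> (tr a b \<circ> p)" by (simp add: o_assoc)
    ultimately show "p \<in> (\<circ>) (tr a b) ` ?Q" by blast
  next
    fix p assume "p \<in> (\<circ>) (tr a b) ` ?Q"
    then obtain q where q: "p = tr a b \<circ> q" "q permutes S" "cyclic_on q A" "cyclic_on q (S - A)"
      by auto
    have "cyclic_on p (A \<union> (S - A))"
      unfolding q(1) using q ab by (intro cyclic_on_merge) auto
    moreover have "A \<union> (S - A) = S" using A by auto
    moreover have "p ` A = tr a b ` A"
      using cyclic_on_imp_image[OF q(3)] by (simp only: q(1) image_comp [symmetric])
    ultimately show "p \<in> ?L" using q perm by (simp add: full_cycles_on_def)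
  qed
qed

lemma card_full_cycles_on_split:
  assumes "finite S" and "A \<subseteq> S" and "a \<in> A" "b \<in> S - A"
  shows "card {p \<in> full_cycles_on S. p ` A = tr a b ` A} =
    card (full_cycles_on A) * card (full_cycles_on (S - A))"
proof -
  have "inj ((\<circ>) (tr a b) :: ('a \<Rightarrow> 'a) \<Rightarrow> 'a \<Rightarrow> 'a)" 
  proof (rule injI)
    fix f g :: "'a \<Rightarrow> 'a"
    assume "tr a b \<circ> f = tr a b \<circ> g"
    then have "tr a b \<circ> tr a b \<circ> f = tr a b \<circ> tr a b \<circ> g" by (simp only: o_assoc [symmetric])
    then show "f = g" by simp
  qed
  then have "card {p \<in> full_cycles_on S. p ` A = tr a b ` A} =
      card {q. q permutes S \<and> cyclic_on q A \<and> cyclic_on q (S - A)}"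
    unfolding full_cycles_on_split[OF assms] by (intro card_image) (auto intro: inj_on_subset)
  also have "\<dots> = card (full_cycles_on A) * card (full_cycles_on (S - A))"
    using card_two_cycles[of A "S - A"] assms finite_subset[OF assms(2,1)]
    by (simp add: Un_absorb1)
  finally show ?thesis .
qed

text \<open>In the induction step the cycles are sorted by the image of the new point
  \<open>a\<close>. Cutting off \<open>a\<close> leaves a full cycle on \<open>S\<close>, so each of
  the \<open>card S\<close> classes has \<open>fact (card S - 1)\<close> members.\<close>

lemma card_full_cycles_on:
  assumes "finite S" and "S \<noteq> {}"
  shows "card (full_cycles_on S) = fact (card S - 1)"
  using assms
proof (induction S rule: finite_ne_induct)
  case (singleton a)
  have "full_cycles_on {a} = {id}" by (auto simp: full_cycles_on_def cyclic_on_singleton)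
  then show ?case by simp
next
  case (insert a S)
  let ?S = "insert a S"
  have one: "card (full_cycles_on {a}) = 1"
  proof -
    have "full_cycles_on {a} = {id}" by (auto simp: full_cycles_on_def cyclic_on_singleton)
    then show ?thesis by simp
  qed
  \<comment> \<open>The condition that \<open>p\<close> sends \<open>a\<close> to \<open>b\<close>,
    in the form required by \<open>card_full_cycles_on_split\<close> for the singleton of
    \<open>a\<close>.\<close>
  let ?F = "\<lambda>b. {p \<in> full_cycles_on ?S. p ` {a} = tr a b ` {a}}"
  have "full_cycles_on ?S = (\<Union>b\<in>S. ?F b)"
  proof (intro subset_antisym subsetI)
    fix p assume p: "p \<in> full_cycles_on ?S"
    then have cyc: "cyclic_on p ?S" by (simp add: full_cycles_on_def)
    have "p a \<noteq> a"
      using cyclic_on_invariant[OF cyc, of "{a}"] insert by auto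
    then have "p a \<in> S" using cyclic_on_inI[OF cyc, of a] by auto
    then show "p \<in> (\<Union>b\<in>S. ?F b)" using p by auto
  qed auto
  also have "card \<dots> = (\<Sum>b\<in>S. card (?F b))"
    using insert by (intro card_UN_disjoint) (auto simp: finite_full_cycles_on)
  also have "\<dots> = (\<Sum>b\<in>S. fact (card S - 1))"
  proof (rule sum.cong)
    fix b assume "b \<in> S"
    then have "card (?F b) = card (full_cycles_on {a}) * card (full_cycles_on (?S - {a}))"
      using insert by (intro card_full_cycles_on_split) auto
    with insert one show "card (?F b) = fact (card S - 1)" by simp
  qed simp
  also have "\<dots> = fact (card ?S - 1)"
    using insert by (simp add: fact_reduce[of "card S"] card_gt_0_iff)
  finally show ?case .
qed

subsection \<open>The average of the full cycles on minors\<close>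

text \<open>A function on finite sets stands for the coordinates of an element of the exterior
  algebra. The positive Vandermonde quotient in \<open>vsign\<close> is only a rescaling of
  coordinates, so for injective \<open>p\<close> this is the usual signed action up to
  conjugation.\<close>

definition minor_action :: "(nat set \<Rightarrow> real) \<Rightarrow> (nat \<Rightarrow> nat) \<Rightarrow> nat set \<Rightarrow> real" where
  "minor_action \<phi> p A = vsign p A * \<phi> (p ` A)"

text \<open>For finite \<open>S\<close> and \<open>A \<subseteq> S\<close> this is the sum of the
  actions of all transpositions of \<open>S\<close>, up to a scalar depending on the sizes: a
  transposition inside \<open>A\<close> acts as -1, and one inside \<open>S - A\<close> acts as
  1.\<close>

definition swap_sum :: "nat set \<Rightarrow> (nat set \<Rightarrow> real) \<Rightarrow> nat set \<Rightarrow> real" where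
  "swap_sum S \<phi> A = (\<Sum>a\<in>A. \<Sum>b\<in>S - A. minor_action \<phi> (tr a b) A)"

lemma minor_action_cong:
  "(\<And>x. x \<in> A \<Longrightarrow> p x = q x) \<Longrightarrow> minor_action \<phi> p A = minor_action \<phi> q A"
  unfolding minor_action_def by (metis (no_types, lifting) image_cong vsign_cong)

lemma minor_action_id [simp]: "minor_action \<phi> id A = \<phi> A"
  by (simp add: minor_action_def)

lemma minor_action_comp:
  assumes "finite A" and "inj_on p A"
  shows "minor_action \<phi> (q \<circ> p) A = vsign p A * minor_action \<phi> q (p ` A)"
  using assms by (simp add: minor_action_def vsign_comp image_comp)

lemma minor_action_comp_tr:
  assumes "finite A" and "a \<in> A" and "b \<in> A" and "a \<noteq> b"
  shows "minor_action \<phi> (q \<circ> tr a b) A = - minor_action \<phi> q A"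
  using assms by (simp add: minor_action_comp vsign_transpose)

section \<open>The quadratic equation of the exchange operator\<close>

lemma sum_antisym_eq_0:
  fixes f :: "'a \<Rightarrow> 'a \<Rightarrow> real"
  assumes "finite A" and "\<And>a c. a \<in> A \<Longrightarrow> c \<in> A \<Longrightarrow> a \<noteq> c \<Longrightarrow> f c a = - f a c"
  shows "(\<Sum>a\<in>A. \<Sum>c\<in>A - {a}. f a c) = 0"
proof -
  have "(\<Sum>a\<in>A. \<Sum>c\<in>A - {a}. f a c) = (\<Sum>a\<in>A. \<Sum>c\<in>A. if a \<noteq> c then f a c else 0)"
    using assms(1) by (intro sum.cong sum.mono_neutral_cong_left) auto
  also have "\<dots> = (\<Sum>c\<in>A. \<Sum>a\<in>A. if a \<noteq> c then f a c else 0)"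
    by (rule sum.swap)
  also have "\<dots> = (\<Sum>c\<in>A. \<Sum>a\<in>A - {c}. f a c)"
    using assms(1) by (intro sum.cong sum.mono_neutral_cong_right) auto
  also have "\<dots> = (\<Sum>c\<in>A. \<Sum>a\<in>A - {c}. - f c a)"
    using assms(2) by (intro sum.cong) auto
  finally show ?thesis by (simp add: sum_negf)
qed

text \<open>A second exchange either undoes the first, or combines with it to a single exchange up
  to sign, or moves a disjoint pair. The contributions of the last kind cancel. The resulting
  quadratic has the roots \<open>card (S - A)\<close> and \<open>- card A\<close>.\<close>

lemma swap_sum_swap_sum:
  assumes fin: "finite S" and A: "A \<subseteq> S"
  shows "swap_sum S (swap_sum S \<phi>) A =
    real (card A * card (S - A)) * \<phi> A + (real (card (S - A)) - real (card A)) * swap_sum S \<phi> A"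
proof -
  let ?t = "\<lambda>p. minor_action \<phi> p A"
  have finA: "finite A" "finite (S - A)" using fin A finite_subset by auto
  \<comment> \<open>After the exchange of \<open>a\<close> and \<open>b\<close>, the point
    \<open>c\<close> leaving the set is \<open>b\<close> or an old one, and the point
    \<open>d\<close> entering it is \<open>a\<close> or a new one. The four terms are these four
    cases.\<close>
  have inner: "minor_action (swap_sum S \<phi>) (tr a b) A =
      \<phi> A + (\<Sum>d\<in>S - A - {b}. ?t (tr a d)) - (\<Sum>c\<in>A - {a}. ?t (tr c b)) +
        (\<Sum>c\<in>A - {a}. \<Sum>d\<in>S - A - {b}. ?t (tr c d \<circ> tr a b))"
    if a: "a \<in> A" and b: "b \<in> S - A" for a b
  proof -
    have ab: "a \<noteq> b" using a b by auto
    have A': "tr a b ` A = insert b (A - {a})" and SA': "S - tr a b ` A = insert a (S - A - {b})"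
      using a b A by (auto simp: tr_image_swap)
    have "minor_action (swap_sum S \<phi>) (tr a b) A =
        (\<Sum>c\<in>tr a b ` A. \<Sum>d\<in>S - tr a b ` A. ?t (tr c d \<circ> tr a b))"
      using finA by (simp add: minor_action_comp minor_action_def[of "swap_sum S \<phi>"] swap_sum_def sum_distrib_left)
    also have "\<dots> = ?t (tr b a \<circ> tr a b) + (\<Sum>d\<in>S - A - {b}. ?t (tr b d \<circ> tr a b)) +
        (\<Sum>c\<in>A - {a}. ?t (tr c a \<circ> tr a b) + (\<Sum>d\<in>S - A - {b}. ?t (tr c d \<circ> tr a b)))"
      unfolding SA' unfolding A' using finA a b by (simp add: sum.distrib)
    also have "?t (tr b a \<circ> tr a b) = \<phi> A"
      by (simp add: transpose_commute[of b a])
    also have "(\<Sum>d\<in>S - A - {b}. ?t (tr b d \<circ> tr a b)) = (\<Sum>d\<in>S - A - {b}. ?t (tr a d))"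
      using a b by (intro sum.cong minor_action_cong) (auto simp: Transposition.transpose_def)
    also have "(\<Sum>c\<in>A - {a}. ?t (tr c a \<circ> tr a b) + (\<Sum>d\<in>S - A - {b}. ?t (tr c d \<circ> tr a b))) =
       (\<Sum>c\<in>A - {a}. - ?t (tr c b) + (\<Sum>d\<in>S - A - {b}. ?t (tr c d \<circ> tr a b)))"
    proof (intro sum.cong refl arg_cong2[of _ _ _ _ "(+)"])
      fix c assume c: "c \<in> A - {a}"
      \<comment> \<open>On \<open>A\<close> both maps send \<open>a\<close> to \<open>b\<close> and
        \<open>c\<close> to \<open>a\<close>. The right-hand side isolates a transposition inside
        \<open>A\<close>, which yields the sign.\<close>
      have "?t (tr c a \<circ> tr a b) = ?t (tr c b \<circ> tr a c)"
        using a b c by (intro minor_action_cong) (auto simp: Transposition.transpose_def)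
      also have "\<dots> = - ?t (tr c b)"
        using a c finA by (intro minor_action_comp_tr) auto
      finally show "?t (tr c a \<circ> tr a b) = - ?t (tr c b)" .
    qed
    finally show ?thesis by (simp add: sum.distrib sum_negf sum_subtractf)
  qed
  have "swap_sum S (swap_sum S \<phi>) A =
      (\<Sum>a\<in>A. \<Sum>b\<in>S - A. \<phi> A) +
      (\<Sum>a\<in>A. \<Sum>b\<in>S - A. \<Sum>d\<in>S - A - {b}. ?t (tr a d)) -
      (\<Sum>a\<in>A. \<Sum>b\<in>S - A. \<Sum>c\<in>A - {a}. ?t (tr c b)) +
      (\<Sum>a\<in>A. \<Sum>b\<in>S - A. \<Sum>c\<in>A - {a}. \<Sum>d\<in>S - A - {b}. ?t (tr c d \<circ> tr a b))"
    unfolding swap_sum_def[of S "swap_sum S \<phi>"]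
    by (simp add: inner sum.distrib sum_subtractf)
  also have "(\<Sum>a\<in>A. \<Sum>b\<in>S - A. \<phi> A) = real (card A * card (S - A)) * \<phi> A"
    by simp
  also have "(\<Sum>a\<in>A. \<Sum>b\<in>S - A. \<Sum>d\<in>S - A - {b}. ?t (tr a d)) =
      (real (card (S - A)) - 1) * swap_sum S \<phi> A"
  proof -
    have "(\<Sum>b\<in>S - A. \<Sum>d\<in>S - A - {b}. ?t (tr a d)) =
        (real (card (S - A)) - 1) * (\<Sum>d\<in>S - A. ?t (tr a d))" for a
      using finA by (simp add: sum_diff1 sum_subtractf algebra_simps)
    then show ?thesis by (simp add: swap_sum_def sum_distrib_left)
  qed
  also have "(\<Sum>a\<in>A. \<Sum>b\<in>S - A. \<Sum>c\<in>A - {a}. ?t (tr c b)) = (real (card A) - 1) * swap_sum S \<phi> A"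
  proof -
    have "(\<Sum>a\<in>A. \<Sum>b\<in>S - A. \<Sum>c\<in>A - {a}. ?t (tr c b)) =
        (\<Sum>a\<in>A. \<Sum>c\<in>A - {a}. \<Sum>b\<in>S - A. ?t (tr c b))"
      by (intro sum.cong sum.swap refl)
    also have "\<dots> = (real (card A) - 1) * swap_sum S \<phi> A"
      using finA by (simp add: swap_sum_def sum_diff1 sum_subtractf algebra_simps)
    finally show ?thesis .
  qed
  also have "(\<Sum>a\<in>A. \<Sum>b\<in>S - A. \<Sum>c\<in>A - {a}. \<Sum>d\<in>S - A - {b}. ?t (tr c d \<circ> tr a b)) =
      (\<Sum>b\<in>S - A. \<Sum>d\<in>S - A - {b}. \<Sum>a\<in>A. \<Sum>c\<in>A - {a}. ?t (tr c d \<circ> tr a b))"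
  proof -
    have "(\<Sum>b\<in>S - A. \<Sum>c\<in>A - {a}. \<Sum>d\<in>S - A - {b}. ?t (tr c d \<circ> tr a b)) =
        (\<Sum>b\<in>S - A. \<Sum>d\<in>S - A - {b}. \<Sum>c\<in>A - {a}. ?t (tr c d \<circ> tr a b))" for a
      by (intro sum.cong sum.swap refl)
    then have "(\<Sum>a\<in>A. \<Sum>b\<in>S - A. \<Sum>c\<in>A - {a}. \<Sum>d\<in>S - A - {b}. ?t (tr c d \<circ> tr a b)) =
        (\<Sum>b\<in>S - A. \<Sum>a\<in>A. \<Sum>d\<in>S - A - {b}. \<Sum>c\<in>A - {a}. ?t (tr c d \<circ> tr a b))"
      by (simp add: sum.swap[of _ A "S - A"])
    also have "\<dots> = (\<Sum>b\<in>S - A. \<Sum>d\<in>S - A - {b}. \<Sum>a\<in>A. \<Sum>c\<in>A - {a}. ?t (tr c d \<circ> tr a b))"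
      by (intro sum.cong sum.swap refl)
    finally show ?thesis .
  qed
  \<comment> \<open>For fixed \<open>b\<close> and \<open>d\<close>, exchanging the roles of
    \<open>a\<close> and \<open>c\<close> amounts to precomposing with \<open>tr a c\<close>, a
    transposition inside \<open>A\<close>. The summand is therefore antisymmetric in
    \<open>a\<close> and \<open>c\<close>.\<close>
  also have "\<dots> = 0"
  proof (rule sum.neutral, rule ballI, rule sum.neutral, rule ballI, rule sum_antisym_eq_0[OF finA(1)])
    fix b d a c assume *: "b \<in> S - A" "d \<in> S - A - {b}" "a \<in> A" "c \<in> A" "a \<noteq> c"
    have "?t (tr a d \<circ> tr c b) = ?t ((tr c d \<circ> tr a b) \<circ> tr a c)"
      using * by (intro minor_action_cong) (auto simp: Transposition.transpose_def)
    also have "\<dots> = - ?t (tr c d \<circ> tr a b)"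
      using * finA by (intro minor_action_comp_tr) auto
    finally show "?t (tr a d \<circ> tr c b) = - ?t (tr c d \<circ> tr a b)" .
  qed
  finally show ?thesis by (simp add: algebra_simps)
qed

section \<open>Averaging over the conjugacy class of full cycles\<close>

lemma full_cycles_on_conj_tr:
  assumes "p \<in> full_cycles_on S" and "a \<in> S" and "c \<in> S"
  shows "tr a c \<circ> p \<circ> tr a c \<in> full_cycles_on S"
proof -
  have p: "p permutes S" "cyclic_on p S" using assms(1) by (auto simp: full_cycles_on_def)
  have "tr a c \<circ> p \<circ> tr a c permutes S"
    using p(1) assms(2,3) by (intro permutes_compose permutes_swap_id)
  moreover have "cyclic_on (tr a c \<circ> p \<circ> tr a c) (tr a c ` S)"
    using p(2) by (rule cyclic_on_image) simp
  moreover have "tr a c ` S = S" using assms(2,3) by (intro transpose_image_eq) simp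
  ultimately show ?thesis by (simp add: full_cycles_on_def)
qed

text \<open>
  Conjugation by the transposition of two points of \<open>A - B\<close> permutes the cycles that map \<open>A\<close>
  to \<open>B\<close> and flips their \<open>vsign\<close>.
\<close>

lemma sum_vsign_full_cycles_far:
  assumes fin: "finite S" and A: "A \<subseteq> S" and ac: "a \<in> A - B" "c \<in> A - B" "a \<noteq> c"
  shows "(\<Sum>p\<in>{p \<in> full_cycles_on S. p ` A = B}. vsign p A) = 0"
proof -
  let ?C = "{p \<in> full_cycles_on S. p ` A = B}" and ?h = "\<lambda>p. tr a c \<circ> p \<circ> tr a c"
  have finA: "finite A" using fin A finite_subset by blast
  have tA: "tr a c ` A = A" and tB: "tr a c ` B = B"
    using ac by (auto simp: tr_image_swap intro!: transpose_image_eq)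
  have closed: "?h p \<in> ?C" if "p \<in> ?C" for p
  proof -
    have "?h p ` A = B" using that by (simp only: image_comp [symmetric] tA) (simp add: tB)
    then show ?thesis using that A ac full_cycles_on_conj_tr[of p S a c] by auto
  qed
  have invol: "?h (?h p) = p" for p by (simp add: fun_eq_iff)
  have sign: "vsign (?h p) A = - vsign p A" if "p \<in> ?C" for p
  proof -
    have pA: "p ` A = B" and inj: "inj_on p A"
      using that by (auto simp: full_cycles_on_def dest: permutes_inj intro: inj_on_subset)
    have "vsign (?h p) A = vsign (tr a c \<circ> p) (tr a c ` A) * vsign (tr a c) A"
      using finA by (intro vsign_comp) auto
    also have "vsign (tr a c) A = -1" using finA ac by (intro vsign_transpose) auto
    also have "vsign (tr a c \<circ> p) (tr a c ` A) = vsign (tr a c) B * vsign p A"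
      unfolding tA using finA inj pA by (subst vsign_comp) auto
    also have "vsign (tr a c) B = vsign id B"
      using ac by (intro vsign_cong) (auto simp: Transposition.transpose_def)
    finally show ?thesis by (simp add: o_def)
  qed
  have "(\<Sum>p\<in>?C. vsign p A) = (\<Sum>p\<in>?C. vsign (?h p) A)"
    using closed invol by (intro sum.reindex_bij_witness[of _ ?h ?h]) auto
  also have "\<dots> = - (\<Sum>p\<in>?C. vsign p A)"
    using sign by (simp add: sum_negf)
  finally show ?thesis by simp
qed

text \<open>The cycles are grouped by the image \<open>B\<close> of \<open>A\<close>. No full cycle
  preserves the proper subset \<open>A\<close>, and if \<open>B\<close> misses at least two points
  of \<open>A\<close> the signs cancel. For \<open>B\<close> obtained by one exchange,
  \<open>full_cycles_on_split\<close> shows that all cycles in the group have the same sign and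
  gives their number.\<close>

lemma sum_minor_action_full_cycles:
  assumes fin: "finite S" and A: "A \<subset> S" "A \<noteq> {}"
  shows "(\<Sum>p\<in>full_cycles_on S. minor_action \<phi> p A) =
    (-1) ^ (card A - 1) * fact (card A - 1) * fact (card (S - A) - 1) * swap_sum S \<phi> A"
proof -
  define K where "K = (-1) ^ (card A - 1) * fact (card A - 1) * (fact (card (S - A) - 1) :: real)"
  have finA: "finite A" "finite (S - A)" using fin A finite_subset by blast+
  let ?C = "\<lambda>B. {p \<in> full_cycles_on S. p ` A = B}"
  let ?B = "(\<lambda>(a, b). tr a b ` A) ` (A \<times> (S - A))"
  have "(\<Sum>p\<in>full_cycles_on S. minor_action \<phi> p A) =
      (\<Sum>B\<in>Pow S. \<Sum>p\<in>?C B. minor_action \<phi> p A)"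
    using fin A by (intro sum.group [symmetric] finite_full_cycles_on)
      (auto simp: full_cycles_on_def permutes_in_image)
  also have "\<dots> = (\<Sum>B\<in>Pow S. \<phi> B * (\<Sum>p\<in>?C B. vsign p A))"
    by (simp add: minor_action_def sum_distrib_left mult.commute)
  also have "\<dots> = (\<Sum>B\<in>?B. \<phi> B * (\<Sum>p\<in>?C B. vsign p A))"
  proof (rule sum.mono_neutral_right)
    show "?B \<subseteq> Pow S" using A by (auto simp: Transposition.transpose_def)
    show "\<forall>B\<in>Pow S - ?B. \<phi> B * (\<Sum>p\<in>?C B. vsign p A) = 0"
    proof
      fix B assume B: "B \<in> Pow S - ?B"
      have "(\<Sum>p\<in>?C B. vsign p A) = 0"
      proof (cases "?C B = {}")
        case False
        then obtain p where p: "p permutes S" "cyclic_on p S" "p ` A = B"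
          by (auto simp: full_cycles_on_def)
        have cardB: "card B = card A"
          using p by (auto intro!: card_image dest: permutes_inj intro: inj_on_subset)
        have finB: "finite B" using finA p by auto
        have "A \<noteq> B" using cyclic_on_invariant[OF p(2), of A] A p(3) by auto
        then have "\<not> A \<subseteq> B" "\<not> B \<subseteq> A"
          using cardB card_subset_eq finA finB by metis+
        then obtain a b where ab: "a \<in> A - B" "b \<in> B - A" by blast
        \<comment> \<open>\<open>A\<close> and \<open>B\<close> have the same size, so if only
          \<open>a\<close> left \<open>A\<close>, a single point entered and \<open>B\<close> would
          arise by one exchange.\<close>
        have "A - B \<noteq> {a}"
        proof
          assume "A - B = {a}"
          moreover have "card (B - A) = card (A - B)"
            using cardB finA finB card_Diff_subset_Int[of A B] card_Diff_subset_Int[of B A]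
            by (simp add: Int_commute)
          ultimately have "card (B - A) = 1" by simp
          then obtain x where "B - A = {x}" by (rule card_1_singletonE)
          with ab have "B - A = {b}" by auto
          with \<open>A - B = {a}\<close> have "B = insert b (A - {a})" by blast
          then have "B = tr a b ` A" using ab by (simp add: tr_image_swap)
          moreover have "b \<in> S" using ab B by auto
          ultimately have "B \<in> ?B" using ab by auto
          with B show False by simp
        qed
        then obtain c where "c \<in> A - B" "a \<noteq> c" using ab by blast
        then show ?thesis using sum_vsign_full_cycles_far[OF fin, of A a B c] A ab by auto
      next
        case True
        then show ?thesis by (simp only: sum.empty)
      qed
      then show "\<phi> B * (\<Sum>p\<in>?C B. vsign p A) = 0" by simp
    qed
  qed (use fin in simp)
  also have "\<dots> = (\<Sum>(a, b)\<in>A \<times> (S - A). \<phi> (tr a b ` A) * (\<Sum>p\<in>?C (tr a b ` A). vsign p A))"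
  proof -
    have inj: "inj_on (\<lambda>(a, b). tr a b ` A) (A \<times> (S - A))"
    proof (rule inj_onI, safe)
      fix a b a' b'
      assume *: "a \<in> A" "b \<in> S" "b \<notin> A" "a' \<in> A" "b' \<in> S" "b' \<notin> A"
        and "tr a b ` A = tr a' b' ` A"
      then have eq: "insert b (A - {a}) = insert b' (A - {a'})" by (simp add: tr_image_swap)
      have "b \<in> insert b' (A - {a'})" using eq by blast
      then show "b = b'" using * by auto
      show "a = a'"
      proof (rule ccontr)
        assume "a \<noteq> a'"
        then have "a \<in> insert b (A - {a})" using * unfolding eq by simp
        then show False using * by auto
      qed
    qed
    show ?thesis
      unfolding sum.reindex[OF inj] by (intro sum.cong refl) (simp only: o_def case_prod_beta)
  qed
  also have "\<dots> = (\<Sum>(a, b)\<in>A \<times> (S - A). K * minor_action \<phi> (tr a b) A)"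
  proof (rule sum.cong)
    fix x assume "x \<in> A \<times> (S - A)"
    then obtain a b where x: "x = (a, b)" and ab: "a \<in> A" "b \<in> S" "b \<notin> A" by blast
    have "vsign p A = vsign (tr a b) A * (-1) ^ (card A - 1)" if p: "p \<in> ?C (tr a b ` A)" for p
    proof -
      have eq: "?C (tr a b ` A) = (\<circ>) (tr a b) ` {q. q permutes S \<and> cyclic_on q A \<and> cyclic_on q (S - A)}"
        using A ab by (intro full_cycles_on_split fin) auto
      obtain q where q: "p = tr a b \<circ> q" "cyclic_on q A"
        using p unfolding eq by blast
      have qA: "q ` A = A" using q(2) by (rule cyclic_on_imp_image)
      then have "vsign p A = vsign (tr a b) A * vsign q A"
        using finA by (simp add: q vsign_comp eq_card_imp_inj_on)
      then show ?thesis using q by (simp add: vsign_cyclic)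
    qed
    then have "(\<Sum>p\<in>?C (tr a b ` A). vsign p A) =
        real (card (?C (tr a b ` A))) * (vsign (tr a b) A * (-1) ^ (card A - 1))"
      by simp
    also have "card (?C (tr a b ` A)) = fact (card A - 1) * fact (card (S - A) - 1)"
      using card_full_cycles_on_split[OF fin, of A a b] A ab finA
      by (auto simp: card_full_cycles_on)
    finally have "\<phi> (tr a b ` A) * (\<Sum>p\<in>?C (tr a b ` A). vsign p A) = K * minor_action \<phi> (tr a b) A"
      by (simp add: K_def minor_action_def)
    then show "(case x of (a, b) \<Rightarrow> \<phi> (tr a b ` A) * (\<Sum>p\<in>?C (tr a b ` A). vsign p A)) =
        (case x of (a, b) \<Rightarrow> K * minor_action \<phi> (tr a b) A)"
      by (simp only: x prod.case)
  qed simp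
  also have "\<dots> = K * swap_sum S \<phi> A"
    by (simp add: swap_sum_def sum.cartesian_product sum_distrib_left case_prod_beta)
  finally show ?thesis by (simp add: K_def)
qed

subsection \<open>Products of random full cycles\<close>

lemma cycle_product_pmf_Suc:
  "cycle_product_pmf N (Suc k) =
    pmf_of_set (full_cycles_on {1..N}) \<bind> (\<lambda>p. map_pmf ((\<circ>) p) (cycle_product_pmf N k))"
  by (simp add: cycle_product_pmf_def full_cycles_def full_cycles_on_def map_bind_pmf
      map_pmf_comp bind_return_pmf' map_pmf_def bind_assoc_pmf bind_return_pmf)

lemma cycle_product_pmf_0: "cycle_product_pmf N 0 = return_pmf id"
  by (simp add: cycle_product_pmf_def)

lemma full_cycles_on_nonempty: "N \<ge> 1 \<Longrightarrow> full_cycles_on {1..N::nat} \<noteq> {}"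
  using full_cycles_nonempty[of N] by (simp add: full_cycles_def full_cycles_on_def)

lemma set_cycle_product_pmf:
  assumes "N \<ge> 1"
  shows "set_pmf (cycle_product_pmf N k) \<subseteq> {\<sigma>. \<sigma> permutes {1..N}}"
proof (induction k)
  case 0
  then show ?case by (simp add: cycle_product_pmf_0 permutes_id)
next
  case (Suc k)
  have "set_pmf (pmf_of_set (full_cycles_on {1..N})) = full_cycles_on {1..N}"
    by (intro set_pmf_of_set full_cycles_on_nonempty[OF assms] finite_full_cycles_on) simp
  then have "set_pmf (pmf_of_set (full_cycles_on {1..N})) \<subseteq> {p. p permutes {1..N}}"
    by (auto simp: full_cycles_on_def)
  then show ?case
    using Suc.IH by (auto simp: cycle_product_pmf_Suc simp del: One_nat_def intro!: permutes_compose)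
qed

lemma finite_set_cycle_product_pmf:
  "N \<ge> 1 \<Longrightarrow> finite (set_pmf (cycle_product_pmf N k))"
  by (rule finite_subset[OF set_cycle_product_pmf]) (simp_all add: finite_permutations)

text \<open>Absorbs the outer factor into the function acted upon, so that an induction on the
  number of factors can generalise over \<open>\<phi>\<close>.\<close>

lemma minor_action_comp':
  assumes "finite A" and "inj_on p A"
  shows "minor_action \<phi> (q \<circ> p) A = minor_action (minor_action \<phi> q) p A"
  using minor_action_comp[OF assms] by (simp add: minor_action_def)

lemma expectation_minor_action_Suc:
  assumes "N \<ge> 1" and A: "A \<subseteq> {1..N}"
  shows "measure_pmf.expectation (cycle_product_pmf N (Suc k)) (\<lambda>\<sigma>. minor_action \<phi> \<sigma> A) =
    (\<Sum>p\<in>full_cycles_on {1..N}.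
      measure_pmf.expectation (cycle_product_pmf N k) (\<lambda>\<sigma>. minor_action (minor_action \<phi> p) \<sigma> A)) / fact (N - 1)"
proof -
  let ?F = "full_cycles_on {1..N}"
  have fin: "finite ?F" "?F \<noteq> {}" using full_cycles_on_nonempty[OF assms(1)]
    by (simp_all add: finite_full_cycles_on)
  have finA: "finite A" using A by (rule finite_subset) simp
  have card: "card ?F = fact (N - 1)" using assms(1) by (subst card_full_cycles_on) auto
  have "measure_pmf.expectation (cycle_product_pmf N (Suc k)) (\<lambda>\<sigma>. minor_action \<phi> \<sigma> A) =
     (\<Sum>p\<in>?F. pmf (pmf_of_set ?F) p *
        measure_pmf.expectation (cycle_product_pmf N k) (\<lambda>\<sigma>. minor_action \<phi> (p \<circ> \<sigma>) A))"
    unfolding cycle_product_pmf_Suc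
    using fin finite_set_cycle_product_pmf[OF assms(1)]
    by (subst pmf_expectation_bind[of ?F]) auto
  also have "\<dots> = (\<Sum>p\<in>?F. measure_pmf.expectation (cycle_product_pmf N k)
      (\<lambda>\<sigma>. minor_action (minor_action \<phi> p) \<sigma> A) / fact (N - 1))"
  proof (rule sum.cong)
    fix p assume "p \<in> ?F"
    have "measure_pmf.expectation (cycle_product_pmf N k) (\<lambda>\<sigma>. minor_action \<phi> (p \<circ> \<sigma>) A) =
      measure_pmf.expectation (cycle_product_pmf N k) (\<lambda>\<sigma>. minor_action (minor_action \<phi> p) \<sigma> A)"
    \<comment> \<open>The composition rule requires injectivity on \<open>A\<close>, which is known
      on the support of the distribution.\<close>
    proof (intro integral_cong_AE)
      show "AE \<sigma> in cycle_product_pmf N k.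
          minor_action \<phi> (p \<circ> \<sigma>) A = minor_action (minor_action \<phi> p) \<sigma> A"
        using set_cycle_product_pmf[OF assms(1), of k] finA
        by (auto simp: AE_measure_pmf_iff intro!: minor_action_comp' dest!: permutes_inj subsetD
            intro: inj_on_subset)
    qed simp_all
    then show "pmf (pmf_of_set ?F) p *
        measure_pmf.expectation (cycle_product_pmf N k) (\<lambda>\<sigma>. minor_action \<phi> (p \<circ> \<sigma>) A) =
      measure_pmf.expectation (cycle_product_pmf N k) (\<lambda>\<sigma>. minor_action (minor_action \<phi> p) \<sigma> A) / fact (N - 1)"
      using \<open>p \<in> ?F\<close> fin card by simp
  qed simp
  finally show ?thesis by (simp add: sum_divide_distrib)
qed

section \<open>Powers of the averaged operator\<close>

lemma swap_sum_cong:
  assumes "finite A" and "A \<subseteq> S" and "\<And>B. B \<subseteq> S \<Longrightarrow> card B = card A \<Longrightarrow> \<phi> B = \<psi> B"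
  shows "swap_sum S \<phi> A = swap_sum S \<psi> A"
  unfolding swap_sum_def minor_action_def
proof (intro sum.cong refl arg_cong2[of _ _ _ _ "(*)"] assms(3))
  fix a b assume *: "a \<in> A" "b \<in> S - A"
  show "tr a b ` A \<subseteq> S" using * assms(2) by (auto simp: Transposition.transpose_def)
  show "card (tr a b ` A) = card A" by (intro card_image) simp
qed

lemma swap_sum_scale: "swap_sum S (\<lambda>B. c * \<phi> B) A = c * swap_sum S \<phi> A"
  by (simp add: swap_sum_def minor_action_def sum_distrib_left algebra_simps)

lemma swap_sum_sum: "swap_sum S (\<lambda>B. \<Sum>i\<in>I. \<phi> i B) A = (\<Sum>i\<in>I. swap_sum S (\<phi> i) A)"
proof -
  have "(\<Sum>i\<in>I. swap_sum S (\<phi> i) A) =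
      (\<Sum>a\<in>A. \<Sum>i\<in>I. \<Sum>b\<in>S - A. minor_action (\<phi> i) (tr a b) A)"
    unfolding swap_sum_def by (rule sum.swap)
  also have "\<dots> = (\<Sum>a\<in>A. \<Sum>b\<in>S - A. \<Sum>i\<in>I. minor_action (\<phi> i) (tr a b) A)"
    by (intro sum.cong sum.swap refl)
  finally show ?thesis by (simp add: swap_sum_def minor_action_def sum_distrib_left)
qed

definition hook_eigenvalue :: "nat \<Rightarrow> nat \<Rightarrow> real" where
  "hook_eigenvalue N j = (-1) ^ j / real ((N - 1) choose j)"

lemma hook_eigenvalue_fact:
  assumes "j < N"
  shows "hook_eigenvalue N j = (-1) ^ j * fact j * fact (N - 1 - j) / fact (N - 1)"
  using assms by (simp add: hook_eigenvalue_def binomial_fact)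

text \<open>On sets of size \<open>card A\<close> the averaged single cycle is a multiple of
  \<open>swap_sum\<close>, with eigenvalues \<open>\<alpha>\<close> and \<open>\<beta>\<close> by
  \<open>swap_sum_swap_sum\<close>. The right-hand side is the Lagrange interpolation of the
  \<open>k\<close>-th power at these two values.\<close>

lemma expectation_minor_action:
  fixes N k :: nat and A :: "nat set"
  defines "\<alpha> \<equiv> hook_eigenvalue N (card A)" and "\<beta> \<equiv> hook_eigenvalue N (card A - 1)"
  assumes A: "A \<subset> {1..N}" "A \<noteq> {}"
  shows "measure_pmf.expectation (cycle_product_pmf N k) (\<lambda>\<sigma>. minor_action \<phi> \<sigma> A) =
    ((real N - real (card A)) * \<alpha> ^ k + real (card A) * \<beta> ^ k) / real N * \<phi> A +
    (\<beta> ^ k - \<alpha> ^ k) / real N * swap_sum {1..N} \<phi> A"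
proof (induction k arbitrary: \<phi>)
  case 0
  have "N > 0" using A by (cases N) auto
  then show ?case by (simp add: cycle_product_pmf_0)
next
  case (Suc k)
  let ?S = "{1..N}"
  define j where "j = card A"
  \<comment> \<open>The factor by which the average of one full cycle multiplies
    \<open>swap_sum\<close> on sets of size \<open>j\<close>. The roots \<open>- j\<close> and
    \<open>N - j\<close> of the quadratic, times \<open>y\<close>, are \<open>\<alpha>\<close> and
    \<open>\<beta>\<close>.\<close>
  define y where "y = (-1) ^ (j - 1) * fact (j - 1) * fact (N - j - 1) / (fact (N - 1) :: real)"
  have N: "N \<ge> 1" using A by (cases N) auto
  have finA: "finite A" using A by (auto intro: finite_subset)
  have j: "0 < j" "j < N"
    using A finA psubset_card_mono[of ?S A] by (auto simp: j_def card_gt_0_iff)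
  have card_diff: "card (?S - B) = N - j" if "B \<subseteq> ?S" "card B = j" for B
    using that by (simp add: card_Diff_subset finite_subset)
  obtain i where i: "j = Suc i" using j by (cases j) auto
  obtain m where m: "N = Suc (j + m)" using j less_iff_Suc_add by auto
  have \<alpha>: "\<alpha> = - real j * y"
    using j by (simp add: \<alpha>_def j_def [symmetric] y_def hook_eigenvalue_fact i field_simps)
  have \<beta>: "\<beta> = (real N - real j) * y"
    using j by (simp add: \<beta>_def j_def [symmetric] y_def hook_eigenvalue_fact i m field_simps)
  have one: "(\<Sum>p\<in>full_cycles_on ?S. minor_action \<phi> p B) / fact (N - 1) = y * swap_sum ?S \<phi> B"
    if "B \<subseteq> ?S" "card B = j" for B
  proof -
    have "B \<subset> ?S" "B \<noteq> {}" using that j by auto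
    then show ?thesis
      using that card_diff[OF that]
      by (simp add: sum_minor_action_full_cycles y_def)
  qed
  let ?x = "((real N - real j) * \<alpha> ^ k + real j * \<beta> ^ k) / real N"
  let ?y = "(\<beta> ^ k - \<alpha> ^ k) / real N"
  have "measure_pmf.expectation (cycle_product_pmf N (Suc k)) (\<lambda>\<sigma>. minor_action \<phi> \<sigma> A) =
    (\<Sum>p\<in>full_cycles_on ?S. ?x * minor_action \<phi> p A + ?y * swap_sum ?S (minor_action \<phi> p) A) / fact (N - 1)"
    using A N by (subst expectation_minor_action_Suc) (auto simp: Suc.IH j_def)
  also have "\<dots> = ?x * ((\<Sum>p\<in>full_cycles_on ?S. minor_action \<phi> p A) / fact (N - 1)) +
      ?y * swap_sum ?S (\<lambda>B. inverse (fact (N - 1)) * (\<Sum>p\<in>full_cycles_on ?S. minor_action \<phi> p B)) A"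
    by (simp only: swap_sum_scale swap_sum_sum sum.distrib sum_distrib_left [symmetric]
        add_divide_distrib) (simp add: field_simps)
  \<comment> \<open>The formula \<open>one\<close> holds for sets of size \<open>j\<close> only;
    this suffices because exchanges preserve the size.\<close>
  also have "swap_sum ?S (\<lambda>B. inverse (fact (N - 1)) * (\<Sum>p\<in>full_cycles_on ?S. minor_action \<phi> p B)) A =
      swap_sum ?S (\<lambda>B. y * swap_sum ?S \<phi> B) A"
    using A finA one by (intro swap_sum_cong) (auto simp: j_def field_simps)
  also have "\<dots> = y * (real j * (real N - real j) * \<phi> A + (real N - 2 * real j) * swap_sum ?S \<phi> A)"
    using A j card_diff[of A]
    by (subst swap_sum_scale, subst swap_sum_swap_sum) (auto simp: j_def [symmetric] of_nat_diff)
  also have "(\<Sum>p\<in>full_cycles_on ?S. minor_action \<phi> p A) / fact (N - 1) = y * swap_sum ?S \<phi> A"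
    using A by (intro one) (auto simp: j_def)
  also have "?x * (y * swap_sum ?S \<phi> A) +
      ?y * (y * (real j * (real N - real j) * \<phi> A + (real N - 2 * real j) * swap_sum ?S \<phi> A)) =
    ((real N - real j) * \<alpha> ^ Suc k + real j * \<beta> ^ Suc k) / real N * \<phi> A +
    (\<beta> ^ Suc k - \<alpha> ^ Suc k) / real N * swap_sum ?S \<phi> A"
  proof -
    have "\<alpha> ^ Suc k = - real j * y * \<alpha> ^ k" "\<beta> ^ Suc k = (real N - real j) * y * \<beta> ^ k"
      by (simp_all add: \<alpha> \<beta>)
    then show ?thesis
      using N by (simp only:) (simp add: field_simps)
  qed
  finally show ?case by (simp only: j_def)
qed

subsection \<open>Inclusion-exclusion over invariant sets\<close>

text \<open>If no cycle lies in \<open>R\<close>, only the empty set contributes. Otherwise fix a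
  cycle \<open>C\<close> inside \<open>R\<close>: adding \<open>C\<close> pairs the invariant sets
  avoiding \<open>C\<close> with those containing it. It multiplies the weight by
  \<open>(-1) ^ card C * (-1) ^ (card C - 1)\<close>, which is -1, so the sum vanishes.\<close>

lemma sum_invariant_sets_vsign:
  assumes fin: "finite S" and \<sigma>: "\<sigma> permutes S" and R: "R \<subseteq> S"
  shows "(\<Sum>A | A \<subseteq> R \<and> \<sigma> ` A = A. (-1) ^ card A * vsign \<sigma> A) =
    of_bool (\<forall>C\<in>cycles_in S \<sigma>. \<not> C \<subseteq> R)"
proof (cases "\<forall>C\<in>cycles_in S \<sigma>. \<not> C \<subseteq> R")
  case True
  have "{A. A \<subseteq> R \<and> \<sigma> ` A = A} = {{}}"
  proof (intro subset_antisym subsetI)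
    fix A assume "A \<in> {A. A \<subseteq> R \<and> \<sigma> ` A = A}"
    then have A: "A \<subseteq> R" "\<sigma> ` A = A" by auto
    have inv: "\<sigma> y \<in> A" if "y \<in> A" for y using imageI[OF that, of \<sigma>] by (simp only: A)
    have False if x: "x \<in> A" for x
    proof -
      have "orbit \<sigma> x \<subseteq> A"
      proof
        fix y assume "y \<in> orbit \<sigma> x"
        then show "y \<in> A" by induction (use x inv in auto)
      qed
      moreover have "orbit \<sigma> x \<in> cycles_in S \<sigma>" using x A R by (auto simp: cycles_in_def)
      ultimately show False using True A by blast
    qed
    then show "A \<in> {{}}" by auto
  qed auto
  then show ?thesis using True by (simp add: vsign_def)
next
  case False
  then obtain C where C: "C \<in> cycles_in S \<sigma>" "C \<subseteq> R" by auto
  have cyc: "cyclic_on \<sigma> C"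
    using C(1) cyclic_on_orbit[OF \<sigma> fin] by (auto simp: cycles_in_def)
  have finC: "finite C" and \<sigma>C: "\<sigma> ` C = C"
    using cyc by (auto simp: finite_cyclic_on cyclic_on_imp_image)
  have C0: "C \<noteq> {}" using cyc by (auto simp: cyclic_on_def)
  have finR: "finite R" using fin R finite_subset by blast
  let ?F = "{A. A \<subseteq> R - C \<and> \<sigma> ` A = A}"
  let ?w = "\<lambda>A. (-1) ^ card A * vsign \<sigma> A"
  have finF: "finite ?F" using finR by simp
  have inj: "inj \<sigma>" using \<sigma> by (rule permutes_inj)
  have split: "{A. A \<subseteq> R \<and> \<sigma> ` A = A} = ?F \<union> (\<lambda>A. A \<union> C) ` ?F"
  proof (intro subset_antisym subsetI)
    fix A assume "A \<in> {A. A \<subseteq> R \<and> \<sigma> ` A = A}"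
    then have A: "A \<subseteq> R" "\<sigma> ` A = A" by auto
    show "A \<in> ?F \<union> (\<lambda>A. A \<union> C) ` ?F"
    proof (cases "A \<inter> C = {}")
      case True
      then show ?thesis using A by auto
    next
      case False
      have "\<sigma> ` (A \<inter> C) \<subseteq> A \<inter> C" using A \<sigma>C by auto
      then have "A \<inter> C = C" using False by (intro cyclic_on_invariant[OF cyc]) auto
      then have "A = (A - C) \<union> C" by auto
      moreover have "A - C \<in> ?F"
        using A \<sigma>C by (auto simp: image_set_diff[OF inj])
      ultimately show ?thesis by blast
    qed
  next
    fix A assume "A \<in> ?F \<union> (\<lambda>A. A \<union> C) ` ?F"
    then show "A \<in> {A. A \<subseteq> R \<and> \<sigma> ` A = A}" using C \<sigma>C by (auto simp: image_Un)
  qed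
  have "(\<Sum>A | A \<subseteq> R \<and> \<sigma> ` A = A. ?w A) = (\<Sum>A\<in>?F. ?w A) + (\<Sum>A\<in>(\<lambda>A. A \<union> C) ` ?F. ?w A)"
    unfolding split using finF C0 by (intro sum.union_disjoint) auto
  also have "(\<Sum>A\<in>(\<lambda>A. A \<union> C) ` ?F. ?w A) = (\<Sum>A\<in>?F. ?w (A \<union> C))"
    by (intro sum.reindex_cong[of "\<lambda>A. A \<union> C"] inj_onI) auto
  also have "\<dots> = (\<Sum>A\<in>?F. - ?w A)"
  proof (intro sum.cong refl)
    fix A assume "A \<in> ?F"
    then have A: "A \<inter> C = {}" "\<sigma> ` A = A" "finite A" using finR finite_subset by blast+
    have "?w (A \<union> C) = (-1) ^ (card A + card C) * (vsign \<sigma> A * (-1) ^ (card C - 1))"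
      using A finC \<sigma>C by (simp add: card_Un_disjoint vsign_union vsign_cyclic[OF cyc])
    also have "\<dots> = ?w A * (-1) ^ (card C + (card C - 1))"
      by (simp add: power_add)
    also have "card C + (card C - 1) = Suc (2 * (card C - 1))"
      using C0 finC by (cases "card C") auto
    finally show "?w (A \<union> C) = - ?w A" by simp
  qed
  finally show ?thesis using False by (simp add: sum_negf)
qed

text \<open>Acting on the indicator function of \<open>A\<close> and evaluating at \<open>A\<close>
  gives \<open>vsign\<close> on the event that \<open>A\<close> is invariant, and 0 elsewhere. The
  expectations depend on \<open>A\<close> through its size only, so the sum over \<open>A\<close>
  collapses to one over sizes.\<close>

lemma p_A1_alternating_sum:
  assumes "1 \<le> l" and "l \<le> N"
  shows "p_A1 N l k = (\<Sum>j\<le>N - l. real ((N - l) choose j) * (-1) ^ j *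
    (((real N - real j) * hook_eigenvalue N j ^ k + real j * hook_eigenvalue N (j - 1) ^ k) / real N))"
proof -
  let ?S = "{1..N}" and ?R = "{l<..N}" and ?M = "cycle_product_pmf N k"
  let ?e = "\<lambda>j. ((real N - real j) * hook_eigenvalue N j ^ k + real j * hook_eigenvalue N (j - 1) ^ k) / real N"
  let ?\<delta> = "\<lambda>A \<sigma>. minor_action (\<lambda>B. of_bool (B = A)) \<sigma> A"
  have N: "N \<ge> 1" using assms by simp
  have fin: "finite (set_pmf ?M)" by (rule finite_set_cycle_product_pmf) fact
  have cycles: "(\<forall>C\<in>cycles_in ?S \<sigma>. C \<inter> {1..l} \<noteq> {}) \<longleftrightarrow> (\<forall>C\<in>cycles_in ?S \<sigma>. \<not> C \<subseteq> ?R)"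
    if "\<sigma> permutes ?S" for \<sigma>
  proof (intro ball_cong refl)
    fix C assume "C \<in> cycles_in ?S \<sigma>"
    then have "C \<subseteq> ?S" using permutes_orbit_subset[OF that] unfolding cycles_in_def by blast
    then show "C \<inter> {1..l} \<noteq> {} \<longleftrightarrow> \<not> C \<subseteq> ?R" by fastforce
  qed
  have "p_A1 N l k = measure_pmf.expectation ?M (indicator {\<sigma>. \<forall>C\<in>cycles_in ?S \<sigma>. C \<inter> {1..l} \<noteq> {}})"
    by (simp add: p_A1_def)
  also have "\<dots> = measure_pmf.expectation ?M (\<lambda>\<sigma>. \<Sum>A\<in>Pow ?R. (-1) ^ card A * ?\<delta> A \<sigma>)"
  proof (rule integral_cong_AE)
    show "AE \<sigma> in ?M. indicator {\<sigma>. \<forall>C\<in>cycles_in ?S \<sigma>. C \<inter> {1..l} \<noteq> {}} \<sigma> =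
        (\<Sum>A\<in>Pow ?R. (-1) ^ card A * ?\<delta> A \<sigma>)"
    proof (rule AE_pmfI)
      fix \<sigma> assume "\<sigma> \<in> set_pmf ?M"
      then have \<sigma>: "\<sigma> permutes ?S" using set_cycle_product_pmf[OF N] by auto
      have "(\<Sum>A\<in>Pow ?R. (-1) ^ card A * ?\<delta> A \<sigma>) =
          (\<Sum>A | A \<subseteq> ?R \<and> \<sigma> ` A = A. (-1) ^ card A * vsign \<sigma> A)"
        by (intro sum.mono_neutral_cong_right) (auto simp: minor_action_def)
      also have "\<dots> = of_bool (\<forall>C\<in>cycles_in ?S \<sigma>. \<not> C \<subseteq> ?R)"
        using \<sigma> by (intro sum_invariant_sets_vsign) auto
      finally show "indicator {\<sigma>. \<forall>C\<in>cycles_in ?S \<sigma>. C \<inter> {1..l} \<noteq> {}} \<sigma> =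
          (\<Sum>A\<in>Pow ?R. (-1) ^ card A * ?\<delta> A \<sigma>)"
        using cycles[OF \<sigma>] by (simp add: indicator_def)
    qed
  qed simp_all
  also have "\<dots> = (\<Sum>A\<in>Pow ?R. (-1) ^ card A * measure_pmf.expectation ?M (?\<delta> A))"
    using fin by (subst Bochner_Integration.integral_sum) (auto intro: integrable_measure_pmf_finite)
  also have "\<dots> = (\<Sum>A\<in>Pow ?R. (-1) ^ card A * ?e (card A))"
  proof (intro sum.cong refl arg_cong2[of _ _ _ _ "(*)"])
    fix A assume "A \<in> Pow ?R"
    then have A: "A \<subset> ?S" using assms by fastforce
    show "measure_pmf.expectation ?M (?\<delta> A) = ?e (card A)"
    proof (cases "A = {}")
      \<comment> \<open>For size 0 the truncated index \<open>j - 1\<close> carries the coefficient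
        0, and \<open>hook_eigenvalue N 0\<close> is 1, so the formula gives the correct value
        1.\<close>
      case True
      then show ?thesis
        using N by (simp add: minor_action_def vsign_def hook_eigenvalue_def)
    next
      case False
      \<comment> \<open>Exchanging a point of \<open>A\<close> for one outside never returns
        \<open>A\<close>.\<close>
      have "swap_sum ?S (\<lambda>B. of_bool (B = A)) A = 0"
        unfolding swap_sum_def minor_action_def
        by (intro sum.neutral ballI) (auto simp: tr_image_swap)
      with A False show ?thesis by (simp add: expectation_minor_action)
    qed
  qed
  also have "\<dots> = (\<Sum>j\<le>N - l. \<Sum>A | A \<in> Pow ?R \<and> card A = j. (-1) ^ card A * ?e (card A))"
    by (intro sum.group [symmetric]) (auto dest: card_mono[rotated])
  also have "\<dots> = (\<Sum>j\<le>N - l. real ((N - l) choose j) * (-1) ^ j * ?e j)"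
    by (intro sum.cong refl) (simp add: n_subsets Pow_def)
  finally show ?thesis .
qed

section \<open>Evaluation of the alternating binomial sum\<close>

lemma sum_binomial_alternating_shift:
  fixes f :: "nat \<Rightarrow> real"
  assumes "l \<le> N" "N \<ge> 1"
  shows "(\<Sum>j\<le>N - l. real ((N - l) choose j) * (-1) ^ j *
      (((real N - real j) * f j + real j * f (j - 1)) / real N)) =
    (\<Sum>j\<le>N - l. (-1) ^ j * real ((N - l) choose j) * real l / real N * f j)"
proof -
  let ?n = "N - l"
  \<comment> \<open>A vanishing top term is added and the vanishing term at 0 dropped, so shifting
    the index restores the range. Absorption then turns \<open>Suc j * (?n choose Suc j)\<close>
    into \<open>(?n - j) * (?n choose j)\<close>.\<close>
  have "(\<Sum>j\<le>?n. real (?n choose j) * (-1) ^ j * real j * f (j - 1)) =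
      (\<Sum>j\<le>Suc ?n. real (?n choose j) * (-1) ^ j * real j * f (j - 1))"
    by simp
  also have "\<dots> = (\<Sum>j\<le>?n. - ((-1) ^ j * real (Suc j * (?n choose Suc j)) * f j))"
    by (subst sum.atMost_Suc_shift) (simp add: algebra_simps)
  also have "\<dots> = (\<Sum>j\<le>?n. - ((-1) ^ j * real ((?n - j) * (?n choose j)) * f j))"
    by (simp only: binomial_absorb_comp [symmetric] binomial_absorption)
  finally have shift: "(\<Sum>j\<le>?n. real (?n choose j) * (-1) ^ j * real j * f (j - 1)) = \<dots>" .
  have "(\<Sum>j\<le>?n. real (?n choose j) * (-1) ^ j * (((real N - real j) * f j + real j * f (j - 1)) / real N)) =
      ((\<Sum>j\<le>?n. real (?n choose j) * (-1) ^ j * (real N - real j) * f j) +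
       (\<Sum>j\<le>?n. real (?n choose j) * (-1) ^ j * real j * f (j - 1))) / real N"
    by (simp add: sum.distrib [symmetric] sum_divide_distrib algebra_simps)
  \<comment> \<open>The coefficients combine through
    \<open>(N - j) - (N - l - j) = l\<close>.\<close>
  also have "\<dots> = (\<Sum>j\<le>?n. (-1) ^ j * real (?n choose j) * real l / real N * f j)"
    unfolding shift sum.distrib [symmetric] sum_divide_distrib
    using assms by (intro sum.cong refl) (simp add: of_nat_diff field_simps)
  finally show ?thesis .
qed

text \<open>In factorials, those of \<open>N - 1 - j\<close> cancel on the right, and the quotients
  of the factorials of \<open>N\<close> and \<open>N - 1\<close>, and of \<open>l\<close> and
  \<open>l - 1\<close>, leave the factor \<open>l / N\<close>.\<close>

lemma binomial_hook_identity:
  assumes "1 \<le> l" and "l \<le> N" and "j \<le> N - l"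
  shows "real ((N - l) choose j) * real l / real N =
    inverse (real (N choose l)) * real ((N - 1) choose j) * real ((N - j - 1) choose (l - 1))"
  using assms fact_reduce[of N, where 'a = real] fact_reduce[of l, where 'a = real]
  by (simp add: binomial_fact field_simps)

theorem theorem4p2:
  fixes N l k :: nat
  assumes "N \<ge> l" and "l \<ge> 1" and "k \<ge> 1"
  shows "p_A1 N l k =
    inverse (real (N choose l)) *
      (\<Sum>m = l..N. (-1) ^ ((k - 1) * (N - m)) *
         real ((N - 1) choose (N - m)) powi (- int k + 1) *
         real ((m - 1) choose (l - 1)))"
proof -
  have N: "N \<ge> 1" using assms by simp
  have "p_A1 N l k = (\<Sum>j\<le>N - l. (-1) ^ j * real ((N - l) choose j) * real l / real N * hook_eigenvalue N j ^ k)"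
    using sum_binomial_alternating_shift[of l N "\<lambda>j. hook_eigenvalue N j ^ k"] assms N
    by (simp only: p_A1_alternating_sum)
  also have "\<dots> = (\<Sum>j\<le>N - l. inverse (real (N choose l)) * ((-1) ^ ((k - 1) * j) *
      real ((N - 1) choose j) powi (- int k + 1) * real ((N - j - 1) choose (l - 1))))"
  proof (intro sum.cong refl)
    fix j assume "j \<in> {..N - l}"
    then have j: "j \<le> N - l" by simp
    define c where "c = real ((N - 1) choose j)"
    have c: "c > 0" using j assms by (simp add: c_def)
    obtain i where i: "k = Suc i" using assms by (cases k) auto
    have pow: "c powi (- int k + 1) = 1 / c ^ i"
      by (simp add: i power_int_minus divide_inverse)
    \<comment> \<open>With \<open>k = Suc i\<close>, the inclusion-exclusion sign and the
      \<open>k\<close> signs of the eigenvalue have total exponent \<open>j + (i + 1) * j\<close>;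
      its even part \<open>2 * j\<close> drops out.\<close>
    have "(-1) ^ j * hook_eigenvalue N j ^ k = (-1) ^ (2 * j + i * j) / c ^ k"
      by (simp add: hook_eigenvalue_def c_def i power_divide power_mult_distrib power_add power_mult algebra_simps flip: power_mult)
    also have "\<dots> = (-1) ^ (i * j) / c ^ k"
      by (simp add: power_add power_mult)
    finally have h: "(-1) ^ j * hook_eigenvalue N j ^ k = (-1) ^ (i * j) / c ^ k" .
    have "(-1) ^ j * real ((N - l) choose j) * real l / real N * hook_eigenvalue N j ^ k =
        (real ((N - l) choose j) * real l / real N) * ((-1) ^ j * hook_eigenvalue N j ^ k)"
      by simp
    also have "\<dots> = inverse (real (N choose l)) * c * real ((N - j - 1) choose (l - 1)) * ((-1) ^ (i * j) / c ^ k)"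
      using assms j by (simp only: h binomial_hook_identity c_def)
    also have "\<dots> = inverse (real (N choose l)) * ((-1) ^ (i * j) * (1 / c ^ i) * real ((N - j - 1) choose (l - 1)))"
      using c by (simp add: i)
    finally show "(-1) ^ j * real ((N - l) choose j) * real l / real N * hook_eigenvalue N j ^ k =
      inverse (real (N choose l)) * ((-1) ^ ((k - 1) * j) *
        real ((N - 1) choose j) powi (- int k + 1) * real ((N - j - 1) choose (l - 1)))"
      unfolding pow [symmetric] by (simp add: i c_def)
  qed
  also have "\<dots> = (\<Sum>m = l..N. inverse (real (N choose l)) * ((-1) ^ ((k - 1) * (N - m)) *
      real ((N - 1) choose (N - m)) powi (- int k + 1) * real ((m - 1) choose (l - 1))))"
    using assms by (intro sum.reindex_bij_witness[of _ "\<lambda>m. N - m" "\<lambda>j. N - j"]) auto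
  finally show ?thesis by (simp add: sum_distrib_left)
qed

end
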